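(* Let $p$ be a prime and let $x, y$ be relatively prime positive integers. Then \[ v_p(x^{p-1}-1)\leq \left\lfloor 283(p-1)\frac{\log y}{\log p}\cdot\frac{\log (xy)}{\log p}\right\rfloor+4. \] Moreover, if $q$ is an odd prime, then \[ v_p(q^{p-1}-1)\leq \left\lfloor 283(p-1)\frac{\log 2}{\log p}\cdot\frac{\log (2q)}{\log p}\right\rfloor+4, \] and \[ v_p(2^{p-1}-1)\leq \left\lfloor 283(p-1)\frac{\log 3}{\log p}\cdot\frac{\log 6}{\log p}\right\rfloor+4. \]
   Context: $v_p(n)$ denotes the exponent of the prime $p$ in the nonzero integer $n$ (the $p$-adic valuation), $\lfloor\cdot\rfloor$ is the floor function, and $\log$ is the natural logarithm.
   Formalization: The first bound is stated for y ≥ 2: with y = 1 it would say v_p(x^{p-1}-1) ≤ 4, which fails for p = 3, x = 244 (244²-1 = 243·245). For x = 1, where v_p(0) is undefined, the valuation is read as 0. *)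

theory Defs
  imports Complex_Main "HOL-Computational_Algebra.Primes"
begin

end

theory Submission
  imports Defs "HOL-Number_Theory.Residues" "HOL-Computational_Algebra.Polynomial"
begin

text \<open>
  Let \<open>p ^ m\<close> divide \<open>x ^ (p - 1) - 1\<close>. If \<open>ln p \<le> 283 * ln y\<close>, then \<open>p ^ m < x ^ (p - 1)\<close> already
  gives the bound. Otherwise \<open>p\<close> is huge and \<open>x\<close> is a root of unity modulo \<open>p ^ m\<close>, so on the pairs
  \<open>(r, n)\<close> for which \<open>x ^ r * y ^ n\<close> lies in a fixed class modulo \<open>p\<close> one has
  \<open>x ^ r * y ^ n \<equiv> \<theta> * Y ^ n\<close> modulo \<open>p ^ m\<close> with \<open>Y \<equiv> 1\<close> modulo \<open>p\<close>: a \<open>p\<close>-adic analytic function of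
  \<open>n\<close> alone. By the pigeonhole principle there are integer-valued polynomials \<open>P0\<close>, \<open>P1\<close> of
  degree less than \<open>K = 4 * (m div 4)\<close> with small coefficients, not both zero, such that
  \<open>P0 n * x ^ (5 * \<rho>) + P1 n * x ^ r * y ^ n\<close> is divisible by \<open>p ^ K\<close> on the whole class. On a suitable
  box this quantity, after removal of the common power of \<open>x\<close>, is smaller than \<open>p ^ K\<close>, hence
  zero. Comparing the relation at \<open>(r, n)\<close> with its translate by a fixed nonzero pair that
  preserves the class forces \<open>P0 = P1 = 0\<close>, since the box contains more than \<open>2 * (K - 1)\<close> points
  of the class.
\<close>

section \<open>Pigeonhole principle and a Siegel lemma in the binomial basis\<close>

lemma large_fibre:
  fixes t :: nat
  assumes "finite C" "f \<in> B \<rightarrow> C" "card C * t < card B"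
  shows "\<exists>c\<in>C. t < card {b \<in> B. f b = c}"
proof (rule ccontr)
  assume "\<not> ?thesis"
  hence small: "\<And>c. c \<in> C \<Longrightarrow> card {b \<in> B. f b = c} \<le> t" by force
  have "card B = card (\<Union>c\<in>C. {b \<in> B. f b = c})"
    using assms(2) by (intro arg_cong[where f = card]) auto
  also have "\<dots> \<le> (\<Sum>c\<in>C. card {b \<in> B. f b = c})"
    by (rule card_UN_le) fact
  also have "\<dots> \<le> card C * t" using small sum_bounded_above[of C "\<lambda>c. card {b \<in> B. f b = c}" t] by simp
  finally show False using assms(3) by simp
qed

text \<open>The coefficients on the right do not depend on \<open>n\<close>, and the
  \<open>i\<close>-th one carries \<open>q ^ (i - k)\<close>, so high coefficients are highly
  divisible when \<open>q\<close> is. The identity follows from \<open>choose_mult\<close> and the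
  binomial theorem for \<open>(1 + q) ^ (n - k)\<close>.\<close>

lemma binomial_mult_power_expansion:
  fixes q :: "'a :: comm_ring_1"
  assumes "n < M"
  shows "of_nat (n choose k) * (1 + q) ^ n =
         (\<Sum>i<M. of_nat (n choose i) * ((1 + q) ^ k * of_nat (i choose k) * q ^ (i - k)))"
proof (cases "k \<le> n")
  case True
  have "(\<Sum>i<M. of_nat (n choose i) * ((1 + q) ^ k * of_nat (i choose k) * q ^ (i - k)))
      = (\<Sum>i=k..n. of_nat (n choose i) * ((1 + q) ^ k * of_nat (i choose k) * q ^ (i - k)))"
  proof (rule sum.mono_neutral_right)
    show "\<forall>i\<in>{..<M} - {k..n}. of_nat (n choose i) * ((1 + q) ^ k * of_nat (i choose k) * q ^ (i - k)) = 0"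
    proof
      fix i assume "i \<in> {..<M} - {k..n}"
      hence "n choose i = 0 \<or> i choose k = 0" by (auto simp: not_le)
      thus "of_nat (n choose i) * ((1 + q) ^ k * of_nat (i choose k) * q ^ (i - k)) = 0"
        by (elim disjE) (simp_all only: of_nat_0 mult_zero_left mult_zero_right)
    qed
  qed (use assms in auto)
  also have "\<dots> = (\<Sum>i=k..n. (1 + q) ^ k * of_nat (n choose k) * (of_nat ((n - k) choose (i - k)) * q ^ (i - k)))"
  proof (rule sum.cong)
    fix i assume i: "i \<in> {k..n}"
    have "of_nat (n choose i) * of_nat (i choose k) = (of_nat (n choose k) * of_nat ((n - k) choose (i - k)) :: 'a)"
      using choose_mult[of k i n] i by (simp flip: of_nat_mult)
    hence "(1 + q) ^ k * q ^ (i - k) * (of_nat (n choose i) * of_nat (i choose k))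
        = (1 + q) ^ k * q ^ (i - k) * (of_nat (n choose k) * of_nat ((n - k) choose (i - k)))"
      by simp
    thus "of_nat (n choose i) * ((1 + q) ^ k * of_nat (i choose k) * q ^ (i - k))
        = (1 + q) ^ k * of_nat (n choose k) * (of_nat ((n - k) choose (i - k)) * q ^ (i - k))"
      by (simp only: mult_ac)
  qed simp
  also have "\<dots> = (1 + q) ^ k * of_nat (n choose k) * (\<Sum>j\<le>n-k. of_nat ((n - k) choose j) * q ^ j)"
    unfolding sum_distrib_left
    by (rule sum.reindex_bij_witness[of _ "\<lambda>j. j + k" "\<lambda>i. i - k"]) (use True in auto)
  also have "(\<Sum>j\<le>n-k. of_nat ((n - k) choose j) * q ^ j) = (1 + q) ^ (n - k)"
    using binomial_ring[of q 1 "n - k"] by (simp add: add.commute)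
  also have "(1 + q) ^ k * of_nat (n choose k) * (1 + q) ^ (n - k) = of_nat (n choose k) * (1 + q) ^ n"
    using True by (simp add: mult.assoc mult.left_commute flip: power_add)
  finally show ?thesis by simp
next
  case False
  have "of_nat (n choose i) * ((1 + q) ^ k * of_nat (i choose k) * q ^ (i - k)) = 0" for i
    using False by (cases "i \<le> n") (auto simp: binomial_eq_0)
  thus ?thesis using False by (simp add: binomial_eq_0)
qed

lemma card_multiples_le:
  fixes d :: int
  assumes "d > 0"
  shows "finite {z \<in> {0..<d * int e}. d dvd z} \<and> card {z \<in> {0..<d * int e}. d dvd z} \<le> e"
proof -
  have sub: "{z \<in> {0..<d * int e}. d dvd z} \<subseteq> (*) d ` {0..<int e}"
    using assms by (auto elim!: dvdE simp: zero_le_mult_iff)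
  have "card {z \<in> {0..<d * int e}. d dvd z} \<le> card ((*) d ` {0..<int e})"
    by (rule card_mono[OF _ sub]) simp
  also have "\<dots> \<le> e" using card_image_le[of "{0..<int e}" "(*) d"] by simp
  finally show ?thesis using finite_subset[OF sub] by blast
qed

text \<open>The summand is the number of free base-\<open>p\<close> digits of a residue modulo
  \<open>p ^ K\<close> divisible by \<open>p ^ (i + 1 - K)\<close>: all \<open>K\<close> digits for
  \<open>i < K\<close>, then \<open>K - 1\<close> down to \<open>0\<close>.\<close>

lemma sum_siegel_exponents:
  fixes K :: nat
  shows "2 * (\<Sum>i<2*K. K - (i + 1 - K)) + K = 3 * K ^ 2"
proof -
  have "(\<Sum>i<2*K. K - (i + 1 - K)) = (\<Sum>i<K. K - (i + 1 - K)) + (\<Sum>i=K..<2*K. K - (i + 1 - K))"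
    unfolding lessThan_atLeast0 by (rule sum.atLeastLessThan_concat[symmetric]) auto
  also have "(\<Sum>i<K. K - (i + 1 - K)) = (\<Sum>i<K. K)" by (intro sum.cong) auto
  also have "(\<Sum>i=K..<2*K. K - (i + 1 - K)) = (\<Sum>j<K. K - Suc j)"
    by (rule sum.reindex_bij_witness[of _ "\<lambda>j. j + K" "\<lambda>i. i - K"]) auto
  also have "\<dots> = (\<Sum>j<K. j)" by (rule sum.nat_diff_reindex)
  finally have "(\<Sum>i<2*K. K - (i + 1 - K)) = K * K + (\<Sum>j<K. j)" by simp
  moreover have "2 * (\<Sum>j<K. j) + K = K * K" by (induction K) auto
  ultimately show ?thesis by (simp add: power2_eq_square)
qed

text \<open>
  In the basis \<open>n choose i\<close> the \<open>i\<close>-th coefficient of the form below is divisible by \<open>p ^ (i + 1 - K)\<close>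
  (truncated subtraction) because \<open>p\<close> divides \<open>q\<close>. So only the coefficients with \<open>i < 2 * K\<close> impose
  conditions, with fewer than \<open>p ^ (3 * K ^ 2 div 2)\<close> joint residues, against \<open>(p ^ (3 * \<kappa>)) ^ (2 * K)\<close>
  choices of \<open>c\<close> and \<open>e\<close>.
\<close>
lemma siegel_binomial:
  fixes p a b q :: int and \<kappa> :: nat
  defines "K \<equiv> 4 * \<kappa>"
  assumes "p > 1" "p dvd q" "\<kappa> > 0"
  obtains c e :: "nat \<Rightarrow> int" where
    "\<And>k. \<bar>c k\<bar> \<le> p ^ (3 * \<kappa>)" "\<And>k. \<bar>e k\<bar> \<le> p ^ (3 * \<kappa>)"
    "\<exists>k<K. c k \<noteq> 0 \<or> e k \<noteq> 0"
    "\<And>n. p ^ K dvd a * (\<Sum>k<K. c k * int (n choose k)) + b * (\<Sum>k<K. e k * int (n choose k)) * (1 + q) ^ n"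
proof -
  define H where "H = p ^ (3 * \<kappa>)"
  have H: "H > 0" using assms by (simp add: H_def)
  have K: "K > 0" using assms by (simp add: K_def)
  \<comment> \<open>\<open>B k i\<close> is the \<open>i\<close>-th coefficient of
    \<open>(n choose k) * (1 + q) ^ n\<close> in the binomial basis. In \<open>A\<close>, the first
    \<open>K\<close> entries of \<open>v\<close> play the role of \<open>c\<close> and the last
    \<open>K\<close> that of \<open>e\<close>.\<close>
  define B where "B = (\<lambda>k i. (1 + q) ^ k * int (i choose k) * q ^ (i - k))"
  define A where "A = (\<lambda>(v :: nat \<Rightarrow> int) i. (if i < K then a * v i else 0) + b * (\<Sum>k<K. v (K + k) * B k i))"
  define \<Phi> where "\<Phi> = (\<lambda>v. restrict (\<lambda>i. A v i mod p ^ K) {..<2*K})"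
  define D where "D = (PiE {..<2*K} (\<lambda>_. {0..<H}))"
  define E where "E = (PiE {..<2*K} (\<lambda>i. {z \<in> {0..<p ^ K}. p ^ (i + 1 - K) dvd z}))"
  have Bdvd: "p ^ (i + 1 - K) dvd B k i" if "k < K" for k i
  proof -
    have "p ^ (i + 1 - K) dvd p ^ (i - k)" using that by (intro le_imp_power_dvd) auto
    also have "p ^ (i - k) dvd q ^ (i - k)" using assms by (intro dvd_power_same)
    finally show ?thesis unfolding B_def by (rule dvd_mult)
  qed
  \<comment> \<open>The summand \<open>a * v i\<close> occurs only for \<open>i < K\<close>, where
    the truncated exponent is \<open>0\<close>.\<close>
  have Adv: "p ^ (i + 1 - K) dvd A v i" for i v
    unfolding A_def by (intro dvd_add dvd_mult dvd_sum) (use Bdvd in auto)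
  have fin: "finite {z \<in> {0..<p ^ K}. p ^ (i + 1 - K) dvd z} \<and>
             card {z \<in> {0..<p ^ K}. p ^ (i + 1 - K) dvd z} \<le> nat (p ^ (K - (i + 1 - K)))"
    if "i < 2 * K" for i
  proof -
    have "p ^ K = p ^ (i + 1 - K) * p ^ (K - (i + 1 - K))"
      using that by (simp flip: power_add)
    thus ?thesis using card_multiples_le[of "p ^ (i + 1 - K)" "nat (p ^ (K - (i + 1 - K)))"] assms by simp
  qed
  have "\<Phi> v \<in> E" for v
  proof -
    have "p ^ (i + 1 - K) dvd A v i mod p ^ K" if "i < 2 * K" for i
      using Adv[of i v] that by (intro dvd_mod) (auto intro!: le_imp_power_dvd)
    thus ?thesis using assms by (auto simp: \<Phi>_def E_def)
  qed
  hence sub: "\<Phi> ` D \<subseteq> E" by auto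
  have finE: "finite E" unfolding E_def by (intro finite_PiE) (use fin in auto)
  have "card E = (\<Prod>i<2*K. card {z \<in> {0..<p ^ K}. p ^ (i + 1 - K) dvd z})"
    unfolding E_def by (simp add: card_PiE)
  also have "\<dots> \<le> (\<Prod>i<2*K. nat p ^ (K - (i + 1 - K)))"
    using fin assms by (intro prod_mono) (auto simp: nat_power_eq)
  also have "\<dots> = nat p ^ (\<Sum>i<2*K. K - (i + 1 - K))" by (simp add: power_sum)
  also have "\<dots> < nat p ^ (3 * \<kappa> * (2 * K))"
  proof (rule power_strict_increasing)
    \<comment> \<open>Making \<open>K\<close> a multiple of 4 keeps the height exponent
      \<open>3 * K / 4\<close> integral; the inequality is strict because
      \<open>K > 0\<close>.\<close>
    have "3 * K ^ 2 = 2 * (3 * \<kappa> * (2 * K))" by (simp add: K_def power2_eq_square)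
    thus "(\<Sum>i<2*K. K - (i + 1 - K)) < 3 * \<kappa> * (2 * K)"
      using sum_siegel_exponents[of K] K by linarith
  qed (use assms in auto)
  also have "\<dots> = card D"
    using assms by (simp add: D_def card_PiE H_def nat_power_eq flip: power_mult)
  finally have "card E < card D" .
  hence "\<not> inj_on \<Phi> D" using card_inj_on_le[OF _ sub finE] by auto
  then obtain v w where vw: "v \<in> D" "w \<in> D" "v \<noteq> w" "\<Phi> v = \<Phi> w" unfolding inj_on_def by blast
  \<comment> \<open>Two vectors with equal residues are subtracted. Setting the entries to 0 from
    \<open>K\<close> on lets the height bounds hold for every index.\<close>
  define c where "c = (\<lambda>k. if k < K then v k - w k else 0)"
  define e where "e = (\<lambda>k. if k < K then v (K + k) - w (K + k) else 0)"
  have rng: "0 \<le> v i \<and> v i < H \<and> 0 \<le> w i \<and> w i < H" if "i < 2 * K" for i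
  proof -
    have "v i \<in> {0..<H}" "w i \<in> {0..<H}"
      using vw that unfolding D_def by (auto simp: PiE_iff)
    thus ?thesis by auto
  qed
  show ?thesis
  proof (rule that[of c e])
    show "\<bar>c k\<bar> \<le> p ^ (3 * \<kappa>)" for k using rng[of k] H unfolding c_def H_def[symmetric] by auto
    show "\<bar>e k\<bar> \<le> p ^ (3 * \<kappa>)" for k using rng[of "K + k"] H unfolding e_def H_def[symmetric] by auto
    obtain i where i: "i < 2 * K" "v i \<noteq> w i"
      using PiE_ext[of v "{..<2*K}" "\<lambda>_. {0..<H}" w] vw unfolding D_def by blast
    show "\<exists>k<K. c k \<noteq> 0 \<or> e k \<noteq> 0"
    proof (cases "i < K")
      case True
      thus ?thesis using i by (auto simp: c_def)
    next
      case False
      hence "i - K < K \<and> e (i - K) \<noteq> 0" using i by (auto simp: e_def)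
      thus ?thesis by blast
    qed
  next
    fix n
    define C where "C = (\<lambda>i. (if i < K then a * c i else 0) + b * (\<Sum>k<K. e k * B k i))"
    have CA: "C i = A v i - A w i" for i
      unfolding C_def A_def c_def e_def by (simp add: algebra_simps sum_subtractf)
    have Cdvd: "p ^ K dvd C i" for i
    proof (cases "i < 2 * K")
      case True
      have "A v i mod p ^ K = A w i mod p ^ K"
        using fun_cong[OF vw(4), of i] True by (simp add: \<Phi>_def)
      thus ?thesis unfolding CA by (simp add: mod_eq_dvd_iff)
    next
      case False
      hence "p ^ K dvd p ^ (i + 1 - K)" by (intro le_imp_power_dvd) auto
      thus ?thesis unfolding CA using Adv dvd_trans dvd_diff by metis
    qed
    \<comment> \<open>Long enough for the expansion, which needs \<open>n < M\<close>, and for all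
      \<open>k < K\<close> in the first sum.\<close>
    define M where "M = n + 1 + K"
    have "(\<Sum>i<M. int (n choose i) * C i)
        = (\<Sum>i<M. int (n choose i) * (if i < K then a * c i else 0))
        + (\<Sum>i<M. \<Sum>k<K. b * e k * (int (n choose i) * B k i))"
      unfolding C_def by (simp add: algebra_simps sum.distrib sum_distrib_left sum_distrib_right)
    also have "(\<Sum>i<M. int (n choose i) * (if i < K then a * c i else 0)) = a * (\<Sum>k<K. c k * int (n choose k))"
      unfolding sum_distrib_left by (rule sum.mono_neutral_cong_right) (auto simp: M_def)
    also have "(\<Sum>i<M. \<Sum>k<K. b * e k * (int (n choose i) * B k i))
             = (\<Sum>k<K. b * e k * (\<Sum>i<M. int (n choose i) * B k i))"
      by (subst sum.swap) (simp add: sum_distrib_left)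
    also have "\<dots> = (\<Sum>k<K. b * e k * (int (n choose k) * (1 + q) ^ n))"
      unfolding B_def using binomial_mult_power_expansion[of n M _ q] by (simp add: M_def)
    also have "\<dots> = b * (\<Sum>k<K. e k * int (n choose k)) * (1 + q) ^ n"
      by (simp add: sum_distrib_left sum_distrib_right algebra_simps)
    finally show "p ^ K dvd a * (\<Sum>k<K. c k * int (n choose k)) + b * (\<Sum>k<K. e k * int (n choose k)) * (1 + q) ^ n"
      using Cdvd by (metis (no_types, lifting) dvd_mult dvd_sum)
  qed
qed

section \<open>Zero estimate and integer-valued polynomials\<close>

lemma card_roots_gt_degree_imp_zero:
  fixes P :: "'a :: idom poly"
  assumes "finite A" "card A > degree P" "\<And>z. z \<in> A \<Longrightarrow> poly P z = 0"
  shows "P = 0"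
proof (rule ccontr)
  assume "P \<noteq> 0"
  hence "card A \<le> card {z. poly P z = 0}"
    using assms by (intro card_mono poly_roots_finite) auto
  also have "\<dots> \<le> degree P" by (rule card_poly_roots_bound) fact
  finally show False using assms by simp
qed

text \<open>Eliminating \<open>w n\<close> between the two relations leaves a polynomial of degree
  at most \<open>2 * D\<close> vanishing on \<open>N\<close>, hence zero. A shift preserves leading
  coefficients, so its top coefficient is \<open>\<omega> - 1\<close> times the product of those of
  \<open>P0\<close> and \<open>P1\<close>; one of them is therefore 0, and then so is the
  other.\<close>

lemma zero_estimate:
  fixes P0 P1 :: "real poly" and w :: "nat \<Rightarrow> real"
  assumes deg: "degree P0 \<le> D" "degree P1 \<le> D"
    and N: "finite N" "card N > 2 * D"
    and om: "\<omega> \<noteq> 1"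
    and w: "\<And>n. n \<in> N \<Longrightarrow> w n \<noteq> 0"
    and z0: "\<And>n. n \<in> N \<Longrightarrow> poly P0 (real n) + poly P1 (real n) * w n = 0"
    and z1: "\<And>n. n \<in> N \<Longrightarrow> poly P0 (real (n + s)) + poly P1 (real (n + s)) * (\<omega> * w n) = 0"
  shows "P0 = 0 \<and> P1 = 0"
proof -
  have card: "card (real ` N) = card N" by (intro card_image) (auto simp: inj_on_def)
  have zero: "P = 0" if "degree P \<le> 2 * D" "\<And>n. n \<in> N \<Longrightarrow> poly P (real n) = 0" for P
    using card_roots_gt_degree_imp_zero[of "real ` N" P] that N card by auto
  define T where "T = [:real s, 1:]"
  have degT: "degree (P \<circ>\<^sub>p T) = degree P" and lcT: "lead_coeff (P \<circ>\<^sub>p T) = lead_coeff P" for P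
    using lead_coeff_comp[of T P] by (simp_all add: T_def degree_pcompose)
  define Q where "Q = smult \<omega> (P0 * (P1 \<circ>\<^sub>p T)) - P1 * (P0 \<circ>\<^sub>p T)"
  have "Q = 0"
  proof (rule zero)
    show "degree Q \<le> 2 * D" unfolding Q_def
    proof (rule degree_diff_le)
      show "degree (smult \<omega> (P0 * (P1 \<circ>\<^sub>p T))) \<le> 2 * D"
        using degree_mult_le[of P0 "P1 \<circ>\<^sub>p T"] degree_smult_le[of \<omega> "P0 * (P1 \<circ>\<^sub>p T)"] degT[of P1] deg by linarith
      show "degree (P1 * (P0 \<circ>\<^sub>p T)) \<le> 2 * D"
        using degree_mult_le[of P1 "P0 \<circ>\<^sub>p T"] degT[of P0] deg by linarith
    qed
    fix n assume n: "n \<in> N"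
    have a: "poly P0 (real n) = - poly P1 (real n) * w n" using z0[OF n] by simp
    have b: "poly P0 (real s + real n) = - poly P1 (real s + real n) * (\<omega> * w n)"
      using z1[OF n] by (simp add: add.commute)
    show "poly Q (real n) = 0" by (simp add: Q_def T_def poly_pcompose a b)
  qed
  hence "coeff Q (degree P0 + degree P1) = 0" by simp
  moreover have "coeff (P0 * (P1 \<circ>\<^sub>p T)) (degree P0 + degree P1) = lead_coeff P0 * lead_coeff P1"
    using coeff_mult_degree_sum[of P0 "P1 \<circ>\<^sub>p T"] degT lcT[of P1] by simp
  moreover have "coeff (P1 * (P0 \<circ>\<^sub>p T)) (degree P0 + degree P1) = lead_coeff P0 * lead_coeff P1"
    using coeff_mult_degree_sum[of P1 "P0 \<circ>\<^sub>p T"] degT lcT[of P0] by (simp add: add.commute)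
  ultimately have "(\<omega> - 1) * (lead_coeff P0 * lead_coeff P1) = 0"
    by (simp add: Q_def algebra_simps)
  hence "P0 = 0 \<or> P1 = 0" using om by auto
  thus ?thesis
  proof
    assume "P0 = 0"
    moreover have "P1 = 0" by (rule zero) (use deg w z0 \<open>P0 = 0\<close> in fastforce)+
    ultimately show ?thesis by simp
  next
    assume "P1 = 0"
    moreover have "P0 = 0" by (rule zero) (use deg z0 \<open>P1 = 0\<close> in fastforce)+
    ultimately show ?thesis by simp
  qed
qed

definition binomial_poly :: "nat \<Rightarrow> 'a :: field_char_0 poly" where
  "binomial_poly k = smult (1 / fact k) (\<Prod>i<k. [:- of_nat i, 1:])"

lemma poly_binomial_poly: "poly (binomial_poly k) (of_nat n) = of_nat (n choose k)"
  by (simp add: binomial_poly_def poly_prod binomial_gbinomial gbinomial_prod_rev lessThan_atLeast0)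

lemma degree_binomial_poly_le: "degree (binomial_poly k) \<le> k"
  unfolding binomial_poly_def
  by (rule order.trans[OF degree_smult_le], rule order.trans[OF degree_prod_sum_le]) auto

text \<open>Turns a binomial sum into a real polynomial, to which root counting applies. The
  coefficients are recovered by evaluating at \<open>0, 1, 2, ...\<close>, a triangular system with
  ones on the diagonal.\<close>

lemma binomial_poly_sum:
  fixes c :: "nat \<Rightarrow> int"
  obtains P :: "real poly" where "degree P \<le> K - 1"
    "\<And>n. poly P (real n) = of_int (\<Sum>k<K. c k * int (n choose k))"
    "P = 0 \<Longrightarrow> \<forall>k<K. c k = 0"
proof -
  define P :: "real poly" where "P = (\<Sum>k<K. smult (of_int (c k)) (binomial_poly k))"
  have val: "poly P (real n) = of_int (\<Sum>k<K. c k * int (n choose k))" for n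
    by (simp add: P_def poly_sum poly_binomial_poly)
  show ?thesis
  proof (rule that[of P])
    show "degree P \<le> K - 1" unfolding P_def
    proof (rule degree_sum_le)
      fix k assume "k \<in> {..<K}"
      thus "degree (smult (of_int (c k)) (binomial_poly k) :: real poly) \<le> K - 1"
        using degree_smult_le[of "of_int (c k)" "binomial_poly k :: real poly"]
          degree_binomial_poly_le[of k, where ?'a = real] by auto
    qed simp
    assume "P = 0"
    hence z: "(\<Sum>k<K. c k * int (n choose k)) = 0" for n using val[of n] by (metis of_int_eq_0_iff poly_0)
    have "m < K \<longrightarrow> c m = 0" for m
    proof (induction m rule: less_induct)
      case (less m)
      show ?case
      proof
        assume "m < K"
        have "(\<Sum>k<K. c k * int (m choose k)) = (\<Sum>k\<in>{m}. c k * int (m choose k))"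
          using less \<open>m < K\<close> by (intro sum.mono_neutral_right) (auto simp: not_less_iff_gr_or_eq)
        thus "c m = 0" using z[of m] by simp
      qed
    qed
    thus "\<forall>k<K. c k = 0" by blast
  qed (rule val)
qed

section \<open>Teichmueller lifting modulo prime powers\<close>

text \<open>Each \<open>p\<close>-th power gains a factor \<open>p\<close>: the cofactor of
  \<open>u - v\<close> in \<open>u ^ p - v ^ p\<close> is congruent to
  \<open>p * v ^ (p - 1)\<close>, hence to 0, modulo \<open>p\<close>.\<close>

lemma cong_prime_power_lift:
  fixes a b :: int
  assumes "[a = b] (mod int p)"
  shows "[a ^ p ^ j = b ^ p ^ j] (mod int p ^ Suc j)"
proof (induction j)
  case 0
  thus ?case using assms by simp
next
  case (Suc j)
  define u v where "u = a ^ p ^ j" and "v = b ^ p ^ j"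
  have uv: "int p ^ Suc j dvd u - v" using Suc by (simp add: cong_iff_dvd_diff u_def v_def)
  have "int p dvd u - v" using uv by (meson dvd_power dvd_trans zero_less_Suc)
  hence m: "[u = v] (mod int p)" by (simp add: cong_iff_dvd_diff)
  have "[(\<Sum>i<p. v ^ (p - Suc i) * u ^ i) = (\<Sum>i<p. v ^ (p - Suc i) * v ^ i)] (mod int p)"
    by (intro cong_sum cong_mult cong_pow m cong_refl)
  also have "(\<Sum>i<p. v ^ (p - Suc i) * v ^ i) = (\<Sum>i<p. v ^ (p - 1))"
    by (intro sum.cong) (auto simp flip: power_add)
  also have "[\<dots> = 0] (mod int p)" by (simp add: cong_0_iff)
  finally have "int p dvd (\<Sum>i<p. v ^ (p - Suc i) * u ^ i)" by (simp add: cong_0_iff)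
  hence "int p ^ Suc j * int p dvd (u - v) * (\<Sum>i<p. v ^ (p - Suc i) * u ^ i)"
    by (intro mult_dvd_mono uv)
  also have "\<dots> = u ^ p - v ^ p" by (simp add: power_diff_sumr2)
  finally show ?case by (simp add: cong_iff_dvd_diff u_def v_def mult.commute flip: power_mult)
qed

text \<open>The witness \<open>\<omega>\<close> is the Teichmueller representative of \<open>y\<close> modulo \<open>p ^ K\<close>.\<close>
lemma power_product_class_lift:
  fixes x y :: int
  assumes p: "prime p" and K: "K > 0" and x: "[x ^ (p - 1) = 1] (mod int p ^ K)" and y: "\<not> int p dvd y"
  obtains \<omega> Y where "[y = \<omega> * Y] (mod int p ^ K)" "int p dvd Y - 1"
    "\<And>r n r' n'. [x ^ r * y ^ n = x ^ r' * y ^ n'] (mod int p) \<Longrightarrow>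
       [x ^ r * \<omega> ^ n = x ^ r' * \<omega> ^ n'] (mod int p ^ K)"
proof -
  define \<omega> where "\<omega> = y ^ p ^ (K - 1)"
  \<comment> \<open>Since \<open>\<omega> ^ (p - 1)\<close> is 1 modulo \<open>p ^ K\<close>, the
    power \<open>\<omega> ^ (p - 2)\<close> is an inverse of \<open>\<omega>\<close>.\<close>
  define Y where "Y = y * \<omega> ^ (p - 2)"
  have p2: "p \<ge> 2" using p by (rule prime_ge_2_nat)
  have pK: "int p ^ Suc (K - 1) = int p ^ K" using K by simp
  have "[nat (y mod int p) ^ (p - 1) = 1] (mod p)"
  proof (rule fermat_theorem[OF p])
    show "\<not> p dvd nat (y mod int p)"
      using y p2 by (metis dvd_mod_iff dvd_refl int_dvd_int_iff nat_0_le not_numeral_le_zero of_nat_0_less_iff pos_mod_sign zero_less_iff_neq_zero)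
  qed
  hence "[int (nat (y mod int p)) ^ (p - 1) = 1] (mod int p)"
    by (metis cong_int_iff of_nat_1 of_nat_power)
  hence fer: "[y ^ (p - 1) = 1] (mod int p)"
    using p2 by (simp add: cong_def power_mod)
  have om1: "[\<omega> ^ (p - 1) = 1] (mod int p ^ K)"
    using cong_prime_power_lift[OF fer, of "K - 1"] unfolding pK \<omega>_def
    by (simp add: mult.commute flip: power_mult)
  have "p - 1 = Suc (p - 2)" using p2 by simp
  hence "\<omega> * Y = y * \<omega> ^ (p - 1)" by (simp add: Y_def mult.left_commute)
  hence 1: "[y = \<omega> * Y] (mod int p ^ K)" using cong_mult[OF cong_refl[of y] om1] by (simp add: cong_sym)
  \<comment> \<open>Because \<open>p ^ j\<close> is 1 modulo \<open>p - 1\<close>, raising to it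
    fixes every element whose \<open>(p - 1)\<close>-th power is 1.\<close>
  have pm: "\<exists>t. p ^ j = 1 + (p - 1) * t" for j
  proof (induction j)
    case (Suc j)
    then obtain t where t: "p ^ j = 1 + (p - 1) * t" by blast
    have "p ^ Suc j = (p - 1) * p ^ j + p ^ j" using p2 by (cases p) auto
    also have "\<dots> = 1 + (p - 1) * (p ^ j + t)" using t by (simp add: algebra_simps)
    finally show ?case by blast
  qed auto
  have fix1: "[a ^ p ^ (K - 1) = a] (mod m)" if "[a ^ (p - 1) = 1] (mod m)" for a m :: int
  proof -
    obtain t where t: "p ^ (K - 1) = 1 + (p - 1) * t" using pm by blast
    have "[a * (a ^ (p - 1)) ^ t = a * 1 ^ t] (mod m)" by (intro cong_mult cong_pow that cong_refl)
    thus ?thesis unfolding t power_add power_mult by simp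
  qed
  have "[Y = y * y ^ (p - 2)] (mod int p)"
    unfolding Y_def \<omega>_def by (intro cong_mult cong_pow fix1 fer cong_refl)
  also have "y * y ^ (p - 2) = y ^ (p - 1)" using \<open>p - 1 = Suc (p - 2)\<close> by simp
  also note fer
  finally have 2: "int p dvd Y - 1" by (simp add: cong_iff_dvd_diff)
  have 3: "[x ^ r * \<omega> ^ n = x ^ r' * \<omega> ^ n'] (mod int p ^ K)"
    if "[x ^ r * y ^ n = x ^ r' * y ^ n'] (mod int p)" for r n r' n'
  proof -
    \<comment> \<open>The power \<open>p ^ (K - 1)\<close> fixes \<open>x\<close> modulo
      \<open>p ^ K\<close> and replaces \<open>y\<close> by \<open>\<omega>\<close>, so it carries a
      congruence modulo \<open>p\<close> to the required one.\<close>
    have E: "[(x ^ r * y ^ n) ^ p ^ (K - 1) = x ^ r * \<omega> ^ n] (mod int p ^ K)" for r n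
    proof -
      have "(x ^ r * y ^ n) ^ p ^ (K - 1) = (x ^ p ^ (K - 1)) ^ r * \<omega> ^ n"
        by (simp add: \<omega>_def power_mult_distrib mult.commute flip: power_mult)
      thus ?thesis using cong_mult[OF cong_pow[OF fix1[OF x], of r] cong_refl[of "\<omega> ^ n"]] by simp
    qed
    show ?thesis using cong_prime_power_lift[OF that, of "K - 1"] E[of r n] E[of r' n'] unfolding pK
      by (meson cong_sym cong_trans)
  qed
  show ?thesis by (rule that[OF 1 2 3])
qed

section \<open>Contradiction from a large valuation\<close>

text \<open>\<open>cnt\<close> puts enough pairs of the box into one class modulo \<open>p\<close>
  for the zero estimate; \<open>sz\<close> keeps the auxiliary values below
  \<open>p ^ (4 * \<kappa>)\<close>, so that divisibility forces them to vanish.\<close>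

lemma no_large_valuation_core:
  fixes p x y \<kappa> \<rho> \<sigma> :: nat
  assumes p: "prime p" and x: "x > 1" and y: "y > 1" and cop: "coprime x y" and py: "\<not> p dvd y"
    and dv: "[int x ^ (p - 1) = 1] (mod int p ^ (4 * \<kappa>))"
    and k: "\<kappa> > 8"
    and sz: "8 * \<kappa> * (y ^ (18 * \<sigma>) * x ^ (5 * \<rho>)) < p ^ \<kappa>"
    and cnt: "(p - 1) * \<kappa> \<le> 8 * (\<rho> * \<sigma>)"
  shows False
proof -
  define K where "K = 4 * \<kappa>"
  have K: "K > 0" using k by (simp add: K_def)
  have p2: "p \<ge> 2" using p by (rule prime_ge_2_nat)
  have px: "\<not> p dvd x"
  proof
    assume "p dvd x"
    hence "int p dvd int x ^ (p - 1)" using p2 dvd_power_le[of "int p" "int x" 1 "p - 1"] by simp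
    moreover have "int p dvd int x ^ (p - 1) - 1"
      using dv k by (metis cong_iff_dvd_diff dvd_power dvd_trans mult_pos_pos zero_less_numeral gr_implies_not0 gr0I)
    ultimately have "int p dvd 1" by (metis dvd_diffD diff_diff_eq2 add_diff_cancel_left' dvd_diff)
    thus False using p2 by simp
  qed
  obtain \<omega> Y where oy: "[int y = \<omega> * Y] (mod int p ^ K)" and Y: "int p dvd Y - 1"
    and lift: "\<And>r n r' n'. [int x ^ r * int y ^ n = int x ^ r' * int y ^ n'] (mod int p) \<Longrightarrow>
       [int x ^ r * \<omega> ^ n = int x ^ r' * \<omega> ^ n'] (mod int p ^ K)"
    using power_product_class_lift[OF p K, of "int x" "int y"] dv py unfolding K_def by auto
  define f where "f = (\<lambda>(r, n). x ^ r * y ^ n mod p)"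
  have f: "f \<in> B \<rightarrow> {1..<p}" for B
  proof -
    have "\<not> p dvd x ^ r * y ^ n" for r n
      using px py p by (metis prime_dvd_mult_iff prime_dvd_power)
    hence "0 < x ^ r * y ^ n mod p" for r n by (simp add: dvd_eq_mod_eq_0)
    thus ?thesis using p2 by (auto simp: f_def Suc_le_eq)
  qed
  have fcong: "[int x ^ r * int y ^ n = int x ^ r' * int y ^ n'] (mod int p) \<longleftrightarrow> f (r, n) = f (r', n')" for r n r' n'
    by (simp add: f_def cong_def flip: of_nat_mult of_nat_power of_nat_mod)

  \<comment> \<open>A small box already has two pairs in one class; their difference is the
    translation used below. It is oriented so that \<open>n\<close> does not decrease, while
    \<open>r\<close> may.\<close>
  have "(p - 1) * 1 < \<rho> * \<sigma>"
  proof -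
    have "8 * (p - 1) < (p - 1) * \<kappa>" using k p2 by simp
    thus ?thesis using cnt by linarith
  qed
  hence "\<exists>c\<in>{1..<p}. 1 < card {b \<in> {..<\<rho>} \<times> {..<\<sigma>}. f b = c}"
    by (intro large_fibre f) (auto simp: card_cartesian_product)
  then obtain c where "1 < card {b \<in> {..<\<rho>} \<times> {..<\<sigma>}. f b = c}" by blast
  then obtain a b where ab: "a \<in> {..<\<rho>} \<times> {..<\<sigma>}" "b \<in> {..<\<rho>} \<times> {..<\<sigma>}" "f a = c" "f b = c" "a \<noteq> b"
    by (auto simp: card_le_Suc0_iff_eq simp flip: not_le)
  have "\<exists>ra na rb nb. ra < \<rho> \<and> na < \<sigma> \<and> rb < \<rho> \<and> nb < \<sigma> \<and> f (ra, na) = f (rb, nb)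
           \<and> (ra, na) \<noteq> (rb, nb) \<and> na \<le> nb"
  proof (cases "snd a \<le> snd b")
    case True
    thus ?thesis using ab by (intro exI[of _ "fst a"] exI[of _ "snd a"] exI[of _ "fst b"] exI[of _ "snd b"]) auto
  next
    case False
    thus ?thesis using ab by (intro exI[of _ "fst b"] exI[of _ "snd b"] exI[of _ "fst a"] exI[of _ "snd a"]) auto
  qed
  then obtain ra na rb nb where lam: "ra < \<rho>" "na < \<sigma>" "rb < \<rho>" "nb < \<sigma>" "f (ra, na) = f (rb, nb)"
     "(ra, na) \<noteq> (rb, nb)" "na \<le> nb" by blast
  define s where "s = nb - na"
  \<comment> \<open>Coprimality makes \<open>x\<close> and \<open>y\<close> multiplicatively
    independent. This later yields \<open>\<Omega> \<noteq> 1\<close>.\<close>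
  have neq: "x ^ ra * y ^ na \<noteq> x ^ rb * y ^ nb"
  proof
    assume eq: "x ^ ra * y ^ na = x ^ rb * y ^ nb"
    hence "x ^ ra * y ^ na = x ^ rb * y ^ s * y ^ na" using lam by (simp add: s_def mult.assoc flip: power_add)
    hence e: "x ^ ra = x ^ rb * y ^ s" using y by simp
    have "coprime (x ^ ra) (y ^ s)" using cop by simp
    hence "y ^ s = 1" using e
      by (metis coprime_common_divisor dvd_refl dvd_triv_right nat_dvd_1_iff_1)
    hence "s = 0" using y by (metis less_irrefl nat_neq_iff one_less_power gr0I)
    hence "na = nb" "ra = rb" using e x lam by (auto simp: s_def)
    thus False using lam by simp
  qed

  have "(p - 1) * (2 * (K - 1)) < 64 * (\<rho> * \<sigma>)"
  proof -
    have "(p - 1) * (2 * (K - 1)) < (p - 1) * (8 * \<kappa>)"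
      using p2 k by (intro mult_strict_left_mono) (auto simp: K_def)
    also have "\<dots> \<le> 64 * (\<rho> * \<sigma>)" using cnt by (simp add: mult.commute)
    finally show ?thesis .
  qed
  \<comment> \<open>The box has \<open>64 * \<rho> * \<sigma>\<close> points. Its margin in
    \<open>r\<close> keeps every translate within \<open>0 \<le> r \<le> 10 * \<rho>\<close> and
    \<open>n < 9 * \<sigma>\<close>.\<close>
  hence "\<exists>c\<in>{1..<p}. 2 * (K - 1) < card {b \<in> {\<rho>..<9*\<rho>} \<times> {..<8*\<sigma>}. f b = c}"
    by (intro large_fibre f) (auto simp: card_cartesian_product algebra_simps)
  then obtain c0 where c0: "2 * (K - 1) < card {b \<in> {\<rho>..<9*\<rho>} \<times> {..<8*\<sigma>}. f b = c0}" by blast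
  define C where "C = {b \<in> {\<rho>..<9*\<rho>} \<times> {..<8*\<sigma>}. f b = c0}"
  have finC: "finite C" unfolding C_def by (rule finite_Collect_conjI) auto
  have "C \<noteq> {}" using c0 unfolding C_def[symmetric] by auto
  then obtain r0 n0 where "(r0, n0) \<in> C" by auto
  hence rn0: "f (r0, n0) = c0" by (simp add: C_def)

  \<comment> \<open>The zero estimate counts values of \<open>n\<close> only. Two points of the
    class with the same \<open>n\<close> would give \<open>x ^ (r' - r)\<close> congruent to 1
    modulo \<open>p ^ K\<close>, impossible by size.\<close>
  have inj: "inj_on snd C"
  proof -
    have no: False if "(r, n) \<in> C" "(r', n) \<in> C" "r < r'" for r r' n
    proof -
      have "f (r, n) = f (r', n)" using that by (simp add: C_def)
      hence "[int x ^ r * int y ^ n = int x ^ r' * int y ^ n] (mod int p)" by (simp add: fcong)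
      moreover have "coprime (int y ^ n) (int p)" using py p
        by (metis coprime_commute coprime_int_iff coprime_power_left_iff prime_imp_coprime)
      ultimately have "[int x ^ r * int y ^ 0 = int x ^ r' * int y ^ 0] (mod int p)" by (simp add: cong_mult_rcancel)
      from lift[OF this] have "[int x ^ r * 1 = int x ^ r * int x ^ (r' - r)] (mod int p ^ K)"
        using that by (simp flip: power_add)
      moreover have "coprime (int x ^ r) (int p ^ K)" using px p
        by (metis coprime_commute coprime_int_iff coprime_power_left_iff coprime_power_right_iff prime_imp_coprime)
      ultimately have "[1 = int x ^ (r' - r)] (mod int p ^ K)" by (simp only: cong_mult_lcancel)
      hence "int p ^ K dvd int x ^ (r' - r) - 1" by (metis cong_iff_dvd_diff cong_sym)
      moreover have "int x ^ (r' - r) > 1" using x that by (simp add: one_less_power)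
      ultimately have "int p ^ K \<le> int x ^ (r' - r) - 1" by (intro zdvd_imp_le) auto
      hence "int p ^ K < int x ^ (r' - r)" by simp
      hence "p ^ K < x ^ (r' - r)" by (metis of_nat_less_iff of_nat_power)
      \<comment> \<open>The exponent is below \<open>8 * \<rho>\<close>; rounding up to
        \<open>20 * \<rho>\<close> gives the fourth power of a quantity bounded through
        \<open>sz\<close>.\<close>
      also have "\<dots> \<le> x ^ (20 * \<rho>)" using that x by (intro power_increasing) (auto simp: C_def)
      also have "\<dots> = (x ^ (5 * \<rho>)) ^ 4" by (simp flip: power_mult)
      also have "\<dots> \<le> (p ^ \<kappa>) ^ 4"
      proof (rule power_mono)
        have "1 * (1 * x ^ (5 * \<rho>)) \<le> 8 * \<kappa> * (y ^ (18 * \<sigma>) * x ^ (5 * \<rho>))"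
          by (intro mult_mono) (use k y in auto)
        thus "x ^ (5 * \<rho>) \<le> p ^ \<kappa>" using sz by linarith
      qed simp
      also have "\<dots> = p ^ K" by (simp add: K_def mult.commute flip: power_mult)
      finally show False by simp
    qed
    show ?thesis
    proof (rule inj_onI)
      fix u v assume uv: "u \<in> C" "v \<in> C" "snd u = snd v"
      obtain r n r' where "u = (r, n)" "v = (r', n)" using uv(3) by (metis prod.collapse)
      thus "u = v" using no uv by (metis linorder_neqE_nat)
    qed
  qed
  define N where "N = snd ` C"
  have cardN: "card N > 2 * (K - 1)" using c0 card_image[OF inj] by (simp add: N_def C_def)

  \<comment> \<open>All pairs \<open>(r, n)\<close> of the class share this value of
    \<open>x ^ r * \<omega> ^ n\<close> modulo \<open>p ^ K\<close>.\<close>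
  define \<theta> where "\<theta> = int x ^ r0 * \<omega> ^ n0"
  obtain c e :: "nat \<Rightarrow> int" where ce: "\<And>k. \<bar>c k\<bar> \<le> int p ^ (3 * \<kappa>)" "\<And>k. \<bar>e k\<bar> \<le> int p ^ (3 * \<kappa>)"
    "\<exists>k<K. c k \<noteq> 0 \<or> e k \<noteq> 0"
    "\<And>n. int p ^ K dvd int x ^ (5 * \<rho>) * (\<Sum>k<K. c k * int (n choose k)) + \<theta> * (\<Sum>k<K. e k * int (n choose k)) * (1 + (Y - 1)) ^ n"
    using siegel_binomial[of "int p" "Y - 1" \<kappa> "int x ^ (5 * \<rho>)" \<theta>] p2 Y k unfolding K_def by auto
  define P0 where "P0 = (\<lambda>n. \<Sum>k<K. c k * int (n choose k))"
  define P1 where "P1 = (\<lambda>n. \<Sum>k<K. e k * int (n choose k))"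
  have bnd: "\<bar>\<Sum>k<K. c k * int (n choose k)\<bar> \<le> int K * int p ^ (3 * \<kappa>) * int y ^ (9 * \<sigma>)"
    if "\<And>k. \<bar>c k\<bar> \<le> int p ^ (3 * \<kappa>)" "n < 9 * \<sigma>" for c :: "nat \<Rightarrow> int" and n
  proof -
    \<comment> \<open>Binomials cost one factor \<open>y ^ (9 * \<sigma>)\<close> and
      \<open>y ^ n\<close> at most another, whence \<open>18 * \<sigma>\<close> in
      \<open>sz\<close>. The factor \<open>8 * \<kappa>\<close> there is \<open>2 * K\<close>: two
      sums of \<open>K\<close> terms.\<close>
    have ch: "int (n choose k) \<le> int y ^ (9 * \<sigma>)" for k
    proof -
      have "n choose k \<le> 2 ^ n" by (rule binomial_le_pow2)
      also have "\<dots> \<le> y ^ n" using y by (intro power_mono) auto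
      also have "\<dots> \<le> y ^ (9 * \<sigma>)" using y that by (intro power_increasing) auto
      finally show ?thesis by (metis of_nat_le_iff of_nat_power)
    qed
    have "\<bar>\<Sum>k<K. c k * int (n choose k)\<bar> \<le> (\<Sum>k<K. \<bar>c k * int (n choose k)\<bar>)" by (rule sum_abs)
    also have "\<dots> \<le> (\<Sum>k<K. int p ^ (3 * \<kappa>) * int y ^ (9 * \<sigma>))"
      unfolding abs_mult using that ch by (intro sum_mono mult_mono) auto
    finally show ?thesis by simp
  qed

  have vanish: "P0 n * int x ^ (5 * \<rho>) + P1 n * (int x ^ r * int y ^ n) = 0"
    if rn: "f (r, n) = c0" "r \<le> 10 * \<rho>" "n < 9 * \<sigma>" for r n
  proof -
    have "[int x ^ r * \<omega> ^ n = \<theta>] (mod int p ^ K)"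
      unfolding \<theta>_def using rn rn0 by (intro lift) (simp add: fcong)
    hence "[int x ^ r * \<omega> ^ n * Y ^ n = \<theta> * Y ^ n] (mod int p ^ K)" by (intro cong_mult cong_refl)
    moreover have "[int x ^ r * int y ^ n = int x ^ r * (\<omega> * Y) ^ n] (mod int p ^ K)"
      by (intro cong_mult cong_pow oy cong_refl)
    ultimately have w: "[int x ^ r * int y ^ n = \<theta> * Y ^ n] (mod int p ^ K)"
      by (simp add: power_mult_distrib mult.assoc) (metis cong_trans)
    have "[P0 n * int x ^ (5 * \<rho>) + P1 n * (int x ^ r * int y ^ n) =
           P0 n * int x ^ (5 * \<rho>) + P1 n * (\<theta> * Y ^ n)] (mod int p ^ K)"
      by (intro cong_add cong_mult w cong_refl)
    also have "[P0 n * int x ^ (5 * \<rho>) + P1 n * (\<theta> * Y ^ n) = 0] (mod int p ^ K)" using ce(4)[of n] by (simp add: P0_def P1_def cong_0_iff mult_ac)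
    finally have d: "int p ^ K dvd P0 n * int x ^ (5 * \<rho>) + P1 n * (int x ^ r * int y ^ n)"
      by (simp add: cong_0_iff)
    \<comment> \<open>The exponent \<open>5 * \<rho>\<close> is the midpoint of the range of
      \<open>r\<close>: after the common power of \<open>x\<close> is removed, at most
      \<open>x ^ (5 * \<rho>)\<close> remains in either term.\<close>
    define u where "u = x ^ (5 * \<rho> - r)"
    define v where "v = x ^ (r - 5 * \<rho>) * y ^ n"
    have fac: "P0 n * int x ^ (5 * \<rho>) + P1 n * (int x ^ r * int y ^ n)
        = int x ^ min r (5 * \<rho>) * (P0 n * int u + P1 n * int v)"
    proof -
      have "x ^ (5 * \<rho>) = x ^ min r (5 * \<rho>) * u" "x ^ r * y ^ n = x ^ min r (5 * \<rho>) * v"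
        by (auto simp: u_def v_def min_def mult.assoc[symmetric] simp flip: power_add)
      hence "int x ^ (5 * \<rho>) = int x ^ min r (5 * \<rho>) * int u"
        "int x ^ r * int y ^ n = int x ^ min r (5 * \<rho>) * int v"
        by (metis of_nat_mult of_nat_power)+
      thus ?thesis by (simp add: algebra_simps)
    qed
    have "coprime (int p ^ K) (int x ^ min r (5 * \<rho>))" using px p
      by (metis coprime_int_iff coprime_power_left_iff coprime_power_right_iff prime_imp_coprime)
    hence dd: "int p ^ K dvd P0 n * int u + P1 n * int v"
      using d unfolding fac by (simp add: coprime_dvd_mult_right_iff)
    define W where "W = y ^ (9 * \<sigma>) * x ^ (5 * \<rho>)"
    have uv: "u \<le> W" "v \<le> W"
    proof -
      have "1 * x ^ (5 * \<rho> - r) \<le> y ^ (9 * \<sigma>) * x ^ (5 * \<rho>)"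
        using x y by (intro mult_mono power_increasing) auto
      thus "u \<le> W" by (simp add: u_def W_def)
      have "x ^ (r - 5 * \<rho>) * y ^ n \<le> x ^ (5 * \<rho>) * y ^ (9 * \<sigma>)"
        using x y rn by (intro mult_mono power_increasing) auto
      thus "v \<le> W" by (simp add: v_def W_def mult.commute)
    qed
    define G where "G = int K * int p ^ (3 * \<kappa>) * int y ^ (9 * \<sigma>)"
    have "\<bar>P0 n * int u + P1 n * int v\<bar> \<le> \<bar>P0 n\<bar> * int u + \<bar>P1 n\<bar> * int v"
      using abs_triangle_ineq[of "P0 n * int u" "P1 n * int v"] by (simp add: abs_mult)
    also have "\<dots> \<le> G * int W + G * int W"
      unfolding P0_def P1_def G_def using uv ce rn
      by (intro add_mono mult_mono bnd) auto
    also have "\<dots> = int (8 * \<kappa> * (y ^ (18 * \<sigma>) * x ^ (5 * \<rho>))) * int p ^ (3 * \<kappa>)"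
    proof -
      have "int y ^ (18 * \<sigma>) = int y ^ (9 * \<sigma>) * int y ^ (9 * \<sigma>)" by (simp flip: power_add)
      thus ?thesis by (simp add: G_def W_def K_def)
    qed
    also have "\<dots> < int (p ^ \<kappa>) * int p ^ (3 * \<kappa>)"
      using sz p2 by (intro mult_strict_right_mono) (simp only: of_nat_less_iff, simp)
    also have "\<dots> = int p ^ K" by (simp add: K_def flip: power_add)
    finally have "\<not> \<bar>int p ^ K\<bar> \<le> \<bar>P0 n * int u + P1 n * int v\<bar>" by simp
    hence "P0 n * int u + P1 n * int v = 0" using dd dvd_imp_le_int by blast
    thus ?thesis using fac by simp
  qed

  obtain Q0 where Q0: "degree Q0 \<le> K - 1" "\<And>n. poly Q0 (real n) = of_int (P0 n)" "Q0 = 0 \<Longrightarrow> \<forall>k<K. c k = 0"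
    using binomial_poly_sum[of K c] unfolding P0_def by blast
  obtain Q1 where Q1: "degree Q1 \<le> K - 1" "\<And>n. poly Q1 (real n) = of_int (P1 n)" "Q1 = 0 \<Longrightarrow> \<forall>k<K. e k = 0"
    using binomial_poly_sum[of K e] unfolding P1_def by blast
  have "\<forall>n\<in>N. \<exists>r. (r, n) \<in> C" by (auto simp: N_def)
  from bchoice[OF this] obtain R where R: "\<And>n. n \<in> N \<Longrightarrow> (R n, n) \<in> C" by blast
  define w where "w = (\<lambda>n. real x ^ R n * real y ^ n / real x ^ (5 * \<rho>))"
  \<comment> \<open>The factor by which translation multiplies \<open>x ^ r * y ^ n\<close>,
    independent of the point.\<close>
  define \<Omega> where "\<Omega> = real x ^ rb * real y ^ nb / (real x ^ ra * real y ^ na)"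
  have x0: "real x > 0" "real y > 0" using x y by auto
  have real_vanish: "real_of_int (P0 n) + real_of_int (P1 n) * (real x ^ r * real y ^ n / real x ^ (5 * \<rho>)) = 0"
    if rn: "f (r, n) = c0" "r \<le> 10 * \<rho>" "n < 9 * \<sigma>" for r n
  proof -
    have "real_of_int (P0 n * int x ^ (5 * \<rho>) + P1 n * (int x ^ r * int y ^ n)) = 0"
      using vanish[OF that] by simp
    hence "real_of_int (P0 n) * real x ^ (5 * \<rho>) + real_of_int (P1 n) * (real x ^ r * real y ^ n) = 0"
      by simp
    thus ?thesis using x0 by (simp add: field_simps)
  qed
  have "Q0 = 0 \<and> Q1 = 0"
  proof (rule zero_estimate[OF Q0(1) Q1(1) _ cardN])
    show "finite N" using finC by (simp add: N_def)
    show "\<Omega> \<noteq> 1"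
    proof
      assume "\<Omega> = 1"
      hence "real x ^ rb * real y ^ nb = real x ^ ra * real y ^ na" using x0 by (simp add: \<Omega>_def)
      hence "real (x ^ rb * y ^ nb) = real (x ^ ra * y ^ na)" by simp
      thus False using neq of_nat_eq_iff by metis
    qed
    fix n assume n: "n \<in> N"
    show "w n \<noteq> 0" using x0 by (simp add: w_def)
    have r: "f (R n, n) = c0" "\<rho> \<le> R n" "R n < 9 * \<rho>" "n < 8 * \<sigma>" using R[OF n] by (auto simp: C_def)
    show "poly Q0 (real n) + poly Q1 (real n) * w n = 0"
      unfolding Q0(2) Q1(2) w_def using r by (intro real_vanish) auto
    \<comment> \<open>The natural subtraction is exact, since
      \<open>ra < \<rho> \<le> R n\<close>.\<close>
    define r' where "r' = R n + rb - ra"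
    have r': "r' + ra = R n + rb" "n + s + na = n + nb" using r lam by (auto simp: r'_def s_def)
    have eq: "(real x ^ r' * real y ^ (n + s)) * (real x ^ ra * real y ^ na)
            = (real x ^ R n * real y ^ n) * (real x ^ rb * real y ^ nb)"
    proof -
      have "(real x ^ r' * real y ^ (n + s)) * (real x ^ ra * real y ^ na) = real x ^ (r' + ra) * real y ^ (n + s + na)"
        by (simp add: power_add)
      also have "\<dots> = (real x ^ R n * real y ^ n) * (real x ^ rb * real y ^ nb)"
        unfolding r' by (simp add: power_add)
      finally show ?thesis .
    qed
    have eqi: "(int x ^ r' * int y ^ (n + s)) * (int x ^ ra * int y ^ na)
            = (int x ^ R n * int y ^ n) * (int x ^ rb * int y ^ nb)"
    proof -
      have "(int x ^ r' * int y ^ (n + s)) * (int x ^ ra * int y ^ na) = int x ^ (r' + ra) * int y ^ (n + s + na)"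
        by (simp add: power_add)
      also have "\<dots> = (int x ^ R n * int y ^ n) * (int x ^ rb * int y ^ nb)"
        unfolding r' by (simp add: power_add)
      finally show ?thesis .
    qed
    have "[int x ^ rb * int y ^ nb = int x ^ ra * int y ^ na] (mod int p)"
      using lam by (simp add: fcong)
    hence "[(int x ^ r' * int y ^ (n + s)) * (int x ^ ra * int y ^ na)
          = (int x ^ R n * int y ^ n) * (int x ^ ra * int y ^ na)] (mod int p)"
      unfolding eqi by (rule cong_mult[OF cong_refl])
    moreover have "coprime (int x ^ ra * int y ^ na) (int p)" using px py p
      by (metis coprime_commute coprime_int_iff coprime_mult_left_iff coprime_power_left_iff prime_imp_coprime)
    ultimately have "[int x ^ r' * int y ^ (n + s) = int x ^ R n * int y ^ n] (mod int p)"
      by (simp only: cong_mult_rcancel)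
    hence "f (r', n + s) = c0" using r by (simp add: fcong)
    moreover have "r' \<le> 10 * \<rho>" "n + s < 9 * \<sigma>" using r lam by (auto simp: r'_def s_def)
    ultimately have "real_of_int (P0 (n + s)) + real_of_int (P1 (n + s)) * (real x ^ r' * real y ^ (n + s) / real x ^ (5 * \<rho>)) = 0"
      by (rule real_vanish)
    moreover have "real x ^ r' * real y ^ (n + s) / real x ^ (5 * \<rho>) = \<Omega> * w n"
      unfolding \<Omega>_def w_def using eq x0 by (simp add: field_simps)
    ultimately show "poly Q0 (real (n + s)) + poly Q1 (real (n + s)) * (\<Omega> * w n) = 0"
      unfolding Q0(2) Q1(2) by simp
  qed
  thus False using Q0(3) Q1(3) ce(3) by blast
qed

section \<open>Choice of the box and numerical estimates\<close>

lemma ln_sq_le: 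
  fixes t :: real assumes "t \<ge> 1" shows "ln t ^ 2 \<le> 4 * t"
proof -
  have "ln t = 2 * ln (sqrt t)" using assms by (simp add: ln_sqrt)
  also have "\<dots> \<le> 2 * sqrt t" using ln_le_minus_one[of "sqrt t"] assms by simp
  finally have "ln t ^ 2 \<le> (2 * sqrt t) ^ 2" using assms by (intro power_mono) auto
  thus ?thesis using assms by (simp add: power_mult_distrib)
qed

text \<open>If the bound fails, \<open>\<rho>\<close> and \<open>\<sigma>\<close> can be taken
  proportional to \<open>k * lp / lx\<close> and \<open>k * lp / ly\<close>: small enough for the
  size condition, yet with a product large enough for the count.\<close>

lemma valuation_bound_large_prime:
  fixes p x y m :: nat
  assumes p: "prime p" and x: "x > 1" and y: "y > 1" and cop: "coprime x y"
    and dv: "int p ^ m dvd int x ^ (p - 1) - 1"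
    and big: "ln (real p) > 283 * ln (real y)"
  shows "real m \<le> 283 * (real p - 1) * ln (real y) * (ln (real x) + ln (real y)) / ln (real p) ^ 2 + 3"
proof (rule ccontr)
  assume "\<not> ?thesis"
  hence m: "real m - 3 > 283 * (real p - 1) * ln (real y) * (ln (real x) + ln (real y)) / ln (real p) ^ 2" by simp
  define lx ly lp where "lx = ln (real x)" and "ly = ln (real y)" and "lp = ln (real p)"
  have ln2: "ln (2::real) \<ge> 1 / 2" using ln_le_minus_one[of "1 / 2 :: real"] by (simp add: ln_div)
  have lx: "lx \<ge> 1/2" using x ln2 ln_le_cancel_iff[of 2 "real x"] unfolding lx_def by linarith
  have ly: "ly \<ge> 1/2" using y ln2 ln_le_cancel_iff[of 2 "real y"] unfolding ly_def by linarith
  have lp: "lp > 283 * ly" using big by (simp add: lp_def ly_def)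
  have lp1: "lp > 141" using lp ly by simp
  have p2: "p \<ge> 2" using p by (rule prime_ge_2_nat)
  have plp: "lp ^ 2 \<le> 4 * real p" unfolding lp_def using p2 by (intro ln_sq_le) simp
  have sq: "lp ^ 2 > 141 * lp" using lp1 by (simp add: power2_eq_square)
  have pbig: "real p - 1 \<ge> 30 * lp" "real p - 1 \<ge> 6/25 * lp ^ 2" using plp sq lp1 by linarith+
  have py: "\<not> p dvd y"
  proof
    assume "p dvd y"
    hence "p \<le> y" using y by (intro dvd_imp_le) auto
    hence "lp \<le> ly" unfolding lp_def ly_def using p2 by simp
    thus False using lp ly by simp
  qed
  \<comment> \<open>Rounding \<open>m\<close> down to a multiple of 4 loses at most 3, the source of
    the \<open>+ 3\<close>.\<close>
  define \<kappa> where "\<kappa> = m div 4"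
  have "int p ^ (4 * \<kappa>) dvd int p ^ m" by (intro le_imp_power_dvd) (simp add: \<kappa>_def)
  hence dvk: "[int x ^ (p - 1) = 1] (mod int p ^ (4 * \<kappa>))" using dv by (metis cong_iff_dvd_diff dvd_trans)
  define k where "k = real \<kappa>"
  have "real m - 3 \<le> 4 * k" unfolding k_def \<kappa>_def by linarith
  hence k1: "4 * k > 283 * (real p - 1) * ly * (lx + ly) / lp ^ 2" using m by (simp add: lx_def ly_def lp_def)
  hence k2: "4 * k * lp ^ 2 > 283 * (real p - 1) * ly * (lx + ly)" using lp1 by (simp add: field_simps)
  have lylx: "ly * (lx + ly) \<ge> 1/2 * 1" using lx ly by (intro mult_mono) auto
  \<comment> \<open>The value \<open>849/25\<close> is \<open>283 * (6/25) * (1/2)\<close>; it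
    exceeds 32, so \<open>k > 8\<close>.\<close>
  have k8: "\<kappa> > 8"
  proof -
    have "283 * (6/25 * lp ^ 2) * (1/2 * 1) \<le> 283 * (real p - 1) * (ly * (lx + ly))"
      by (rule mult_mono) (use pbig lylx p2 in auto)
    also have "\<dots> < 4 * k * lp ^ 2" using k2 by (simp only: mult.assoc)
    finally have "849/25 * lp ^ 2 < 4 * k * lp ^ 2" by simp
    hence "849/25 < 4 * k" using lp1 by (subst (asm) mult_less_cancel_right_pos) auto
    thus ?thesis by (simp add: k_def)
  qed
  \<comment> \<open>The powers of \<open>x\<close> and \<open>y\<close> each use 49 percent of \<open>k * lp\<close>; the remaining 2 percent absorbs the factor \<open>8 * k\<close>.\<close>
  define \<rho>' where "\<rho>' = 49 / 500 * (k * lp / lx)"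
  define \<sigma>' where "\<sigma>' = 49 / 1800 * (k * lp / ly)"
  define \<rho> where "\<rho> = nat \<lfloor>\<rho>'\<rfloor>"
  define \<sigma> where "\<sigma> = nat \<lfloor>\<sigma>'\<rfloor>"
  have k0: "k > 0" using k8 by (simp add: k_def)
  have pos: "\<rho>' > 0" "\<sigma>' > 0" using k0 lp1 lx ly by (auto simp: \<rho>'_def \<sigma>'_def)
  have rs: "real \<rho> \<le> \<rho>'" "real \<sigma> \<le> \<sigma>'" "real \<rho> > \<rho>' - 1" "real \<sigma> > \<sigma>' - 1"
    unfolding \<rho>_def \<sigma>_def using pos by linarith+
  have size: "8 * \<kappa> * (y ^ (18 * \<sigma>) * x ^ (5 * \<rho>)) < p ^ \<kappa>"
  proof -
    have k9: "k \<ge> 9" using k8 by (simp add: k_def)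
    \<comment> \<open>The target \<open>14/5\<close> lies just below \<open>141/50\<close>, and
      \<open>lp > 141\<close>.\<close>
    have "ln (8 * k) ^ 2 \<le> 4 * (8 * k)" using k9 by (intro ln_sq_le) simp
    also have "\<dots> < 7 * 9 * k" using k9 by simp
    also have "\<dots> \<le> 7 * k * k" using k9 by (intro mult_right_mono) auto
    also have "\<dots> \<le> (14/5 * k) ^ 2" using k9 by (simp add: power2_eq_square)
    finally have "ln (8 * k) < 14/5 * k" using k9 by (intro power2_less_imp_less[of "ln (8 * k)"]) auto
    moreover have "k * lp \<ge> k * 141" using k0 lp1 by (intro mult_left_mono) auto
    ultimately have l8: "ln (8 * k) < k * lp / 50" using k9 by linarith
    have "18 * real \<sigma> * ly \<le> 18 * \<sigma>' * ly" using rs ly by (intro mult_right_mono) auto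
    also have "\<dots> = 49/100 * (k * lp)" using ly by (simp add: \<sigma>'_def)
    finally have a: "18 * real \<sigma> * ly \<le> 49/100 * (k * lp)" .
    have "5 * real \<rho> * lx \<le> 5 * \<rho>' * lx" using rs lx by (intro mult_right_mono) auto
    also have "\<dots> = 49/100 * (k * lp)" using lx by (simp add: \<rho>'_def)
    finally have b: "5 * real \<rho> * lx \<le> 49/100 * (k * lp)" .
    have "ln (8 * k * (real y ^ (18 * \<sigma>) * real x ^ (5 * \<rho>))) = ln (8 * k) + 18 * real \<sigma> * ly + 5 * real \<rho> * lx"
      using k0 x y by (simp add: ln_mult ln_realpow lx_def ly_def)
    also have "\<dots> < k * lp" using l8 a b by linarith
    also have "\<dots> = ln (real p ^ \<kappa>)" using p2 by (simp add: ln_realpow k_def lp_def)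
    finally have "8 * k * (real y ^ (18 * \<sigma>) * real x ^ (5 * \<rho>)) < real p ^ \<kappa>"
      using k0 x y p2 by (subst (asm) ln_less_cancel_iff) auto
    hence "real (8 * \<kappa> * (y ^ (18 * \<sigma>) * x ^ (5 * \<rho>))) < real (p ^ \<kappa>)" by (simp add: k_def)
    thus ?thesis by (simp only: of_nat_less_iff)
  qed
  have count: "(p - 1) * \<kappa> \<le> 8 * (\<rho> * \<sigma>)"
  proof -
    \<comment> \<open>Here \<open>4245\<close> is \<open>283 * 30 / 2\<close>. The resulting lower
      bound 1050 makes \<open>\<rho>'\<close> and \<open>\<sigma>'\<close> exceed 10, so the floors
      lose at most a tenth.\<close>
    define qx where "qx = k * lp / lx"
    have "283 * (30 * lp) * (1/2) * lx \<le> 283 * (real p - 1) * ly * (lx + ly)"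
      using pbig lx ly lp1 by (intro mult_mono) auto
    also have "\<dots> \<le> 4 * k * lp ^ 2" using k2 by simp
    also have "\<dots> = 4 * qx * (lx * lp)" using lx by (simp add: qx_def power2_eq_square)
    finally have "4245 * (lx * lp) \<le> 4 * qx * (lx * lp)" using mult_nonneg_nonneg[of lx lp] lx lp1 by (simp add: mult_ac)
    hence "4245 \<le> 4 * qx" using lx lp1 by (subst (asm) mult_le_cancel_right_pos) auto
    hence r10: "k * lp / lx \<ge> 1050" by (simp add: qx_def)
    define qy where "qy = k * lp / ly"
    have "283 * (30 * lp) * ly * (1/2) \<le> 283 * (real p - 1) * ly * (lx + ly)"
      using pbig lx ly lp1 by (intro mult_mono) auto
    also have "\<dots> \<le> 4 * k * lp ^ 2" using k2 by simp
    also have "\<dots> = 4 * qy * (ly * lp)" using ly by (simp add: qy_def power2_eq_square)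
    finally have "4245 * (ly * lp) \<le> 4 * qy * (ly * lp)" using mult_nonneg_nonneg[of ly lp] ly lp1 by (simp add: mult_ac)
    hence "4245 \<le> 4 * qy" using ly lp1 by (subst (asm) mult_le_cancel_right_pos) auto
    hence s10: "k * lp / ly \<ge> 1050" by (simp add: qy_def)
    have r: "real \<rho> \<ge> 9/10 * \<rho>'" and s: "real \<sigma> \<ge> 9/10 * \<sigma>'"
      using rs r10 s10 unfolding \<rho>'_def \<sigma>'_def by linarith+
    have "real (p - 1) * k \<le> 8 * ((9/10 * \<rho>') * (9/10 * \<sigma>'))"
    proof -
      have "(real p - 1) * k * (lx * ly) = (k * (real p - 1) * ly) * lx" by simp
      also have "\<dots> \<le> (k * (real p - 1) * ly) * (lx + ly)"
        using k0 p2 lx ly by (intro mult_left_mono) auto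
      also have "\<dots> = k * ((real p - 1) * ly * (lx + ly))" by simp
      also have "\<dots> \<le> k * (4 / 283 * k * lp ^ 2)"
      proof (rule mult_left_mono)
        have "283 * ((real p - 1) * ly * (lx + ly)) < 4 * k * lp ^ 2" using k2 by (simp only: mult.assoc)
        thus "(real p - 1) * ly * (lx + ly) \<le> 4 / 283 * k * lp ^ 2" by simp
      qed (use k0 in simp)
      \<comment> \<open>This is where 283 enters the count: \<open>4/283\<close> is about 0.0141,
        the constant on the right about 0.0173.\<close>
      also have "\<dots> \<le> k * ((81/100 * 8 * (49/500) * (49/1800)) * k * lp ^ 2)"
        using k0 by (intro mult_left_mono mult_right_mono) auto
      also have "\<dots> = 8 * ((9/10 * \<rho>') * (9/10 * \<sigma>')) * (lx * ly)"
        using lx ly by (simp add: \<rho>'_def \<sigma>'_def power2_eq_square)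
      finally show ?thesis using lx ly p2 by (simp add: of_nat_diff)
    qed
    also have "\<dots> \<le> 8 * (real \<rho> * real \<sigma>)" using r s pos by (intro mult_left_mono mult_mono) auto
    finally have "real ((p - 1) * \<kappa>) \<le> real (8 * (\<rho> * \<sigma>))" by (simp add: k_def)
    thus ?thesis by (simp only: of_nat_le_iff)
  qed
  show False by (rule no_large_valuation_core[OF p x y cop py dvk k8 size count])
qed

section \<open>Valuation bounds for all primes\<close>

lemma fermat_quotient_valuation_bound:
  fixes p x y :: nat
  assumes p: "prime p" and x: "x > 0" and y: "y > 1" and cop: "coprime x y"
  shows "int (multiplicity (int p) (int x ^ (p - 1) - 1))
         \<le> \<lfloor>283 * (real p - 1) * (ln (real y) / ln (real p)) * (ln (real x * real y) / ln (real p))\<rfloor> + 4"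
proof -
  define m where "m = multiplicity (int p) (int x ^ (p - 1) - 1)"
  define V where "V = 283 * (real p - 1) * (ln (real y) / ln (real p)) * (ln (real x * real y) / ln (real p))"
  have p2: "p \<ge> 2" using p by (rule prime_ge_2_nat)
  have lp: "ln (real p) > 0" and ly: "ln (real y) > 0" and lx0: "ln (real x) \<ge> 0" using p2 y x by auto
  have V: "V = 283 * (real p - 1) * ln (real y) * (ln (real x) + ln (real y)) / ln (real p) ^ 2"
    using x y by (simp add: V_def ln_mult power2_eq_square)
  have V0: "V \<ge> 0" unfolding V using lp ly lx0 p2 by (intro divide_nonneg_pos mult_nonneg_nonneg) auto
  have "real m \<le> V + 3"
  \<comment> \<open>For \<open>x = 1\<close> the difference is 0, and \<open>multiplicity\<close>
    takes the default value 0 there.\<close>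
  proof (cases "x = 1")
    case True
    thus ?thesis using V0 by (simp add: m_def)
  next
    case False
    hence x1: "x > 1" using x by simp
    have dv: "int p ^ m dvd int x ^ (p - 1) - 1" unfolding m_def by (rule multiplicity_dvd)
    show ?thesis
    proof (cases "ln (real p) > 283 * ln (real y)")
      case True
      show ?thesis unfolding V by (rule valuation_bound_large_prime[OF p x1 y cop dv True])
    next
      case False
      have "int x ^ (p - 1) > 1" using x1 p2 by (intro one_less_power) auto
      hence "int p ^ m \<le> int x ^ (p - 1) - 1" by (intro zdvd_imp_le dv) auto
      hence "int p ^ m \<le> int x ^ (p - 1)" by simp
      hence "p ^ m \<le> x ^ (p - 1)" by (metis of_nat_le_iff of_nat_power)
      hence "real p ^ m \<le> real x ^ (p - 1)" by (metis of_nat_le_iff of_nat_power)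
      hence "ln (real p ^ m) \<le> ln (real x ^ (p - 1))" using p2 x1 by (subst ln_le_cancel_iff) auto
      hence a: "real m * ln (real p) \<le> (real p - 1) * ln (real x)"
        using p2 x1 by (simp add: ln_realpow of_nat_diff)
      have "real m * ln (real p) ^ 2 \<le> (real p - 1) * ln (real x) * ln (real p)"
        using mult_right_mono[OF a, of "ln (real p)"] lp by (simp add: power2_eq_square mult.assoc)
      \<comment> \<open>For such \<open>p\<close>, one factor \<open>ln p\<close> is at most
        \<open>283 * ln y\<close>, so the trivial size bound suffices.\<close>
      also have "\<dots> \<le> (real p - 1) * (ln (real x) + ln (real y)) * (283 * ln (real y))"
        using False lp ly lx0 p2 by (intro mult_mono) auto
      finally have "real m \<le> V" unfolding V using lp by (simp add: pos_le_divide_eq algebra_simps)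
      thus ?thesis by simp
    qed
  qed
  hence "int m \<le> \<lfloor>V\<rfloor> + 4" by linarith
  thus ?thesis by (simp add: m_def V_def)
qed

theorem theorem2:
  fixes p :: nat
  assumes "prime p"
  shows "(\<forall>x y :: nat. x > 0 \<and> y > 1 \<and> coprime x y \<longrightarrow>
            int (multiplicity (int p) (int x ^ (p - 1) - 1))
              \<le> \<lfloor>283 * (real p - 1) * (ln (real y) / ln (real p)) * (ln (real x * real y) / ln (real p))\<rfloor> + 4)
       \<and> (\<forall>q :: nat. prime q \<and> odd q \<longrightarrow>
            int (multiplicity (int p) (int q ^ (p - 1) - 1))
              \<le> \<lfloor>283 * (real p - 1) * (ln 2 / ln (real p)) * (ln (2 * real q) / ln (real p))\<rfloor> + 4)
       \<and> int (multiplicity (int p) (2 ^ (p - 1) - 1))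
              \<le> \<lfloor>283 * (real p - 1) * (ln 3 / ln (real p)) * (ln 6 / ln (real p))\<rfloor> + 4"
proof (intro conjI allI impI)
  fix x y :: nat
  assume "x > 0 \<and> y > 1 \<and> coprime x y"
  thus "int (multiplicity (int p) (int x ^ (p - 1) - 1))
          \<le> \<lfloor>283 * (real p - 1) * (ln (real y) / ln (real p)) * (ln (real x * real y) / ln (real p))\<rfloor> + 4"
    by (intro fermat_quotient_valuation_bound[OF assms]) auto
next
  fix q :: nat
  assume "prime q \<and> odd q"
  thus "int (multiplicity (int p) (int q ^ (p - 1) - 1))
          \<le> \<lfloor>283 * (real p - 1) * (ln 2 / ln (real p)) * (ln (2 * real q) / ln (real p))\<rfloor> + 4"
    \<comment> \<open>The smallest admissible \<open>y\<close> is chosen: 2 for an odd prime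
      \<open>q\<close>, and 3 for the base 2.\<close>
    using fermat_quotient_valuation_bound[OF assms, of q 2] by (simp add: prime_gt_0_nat mult.commute[of 2])
next
  have "coprime (2 :: nat) 3" by (simp add: coprime_iff_gcd_eq_1 gcd_nat.simps)
  thus "int (multiplicity (int p) (2 ^ (p - 1) - 1))
          \<le> \<lfloor>283 * (real p - 1) * (ln 3 / ln (real p)) * (ln 6 / ln (real p))\<rfloor> + 4"
    using fermat_quotient_valuation_bound[OF assms, of 2 3] by simp
qed

end
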